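(* Let $h>0$, $u_m$ and $\boldsymbol{\alpha}=(\alpha_1,\dots,\alpha_N)^{\rm T}$ be a smooth solution of the shallow water moment equations (SWME) \begin{align*} \partial_t h+\partial_x(h u_m) &= 0,\\ \partial_t(h u_m)+\partial_x \Big(h u_m^2+ h\sum_{i=1}^N\tfrac{\alpha_i^2}{2i+1} +\tfrac{1}{2} g h^2\Big) &= - gh\, \partial_x b,\\ \partial_t(h \alpha_i)+\partial_x\Big( 2 h u_m \alpha_i+h\sum_{j,k=1}^N A_{ijk}\alpha_j\alpha_k \Big) &= u_m \partial_x(h \alpha_i) - \sum_{j,k=1}^N B_{ijk}\,\alpha_k\,\partial_x(h\alpha_j),\qquad i=1,\dots,N, \end{align*} for $x\in\Omega$, $t>0$. Then the total energy $\mathbb{E}$ is a conserved quantity, with total energy equation $$\partial_t \mathbb{E}(\boldsymbol{u}) + \partial_x \mathbb{F}(\boldsymbol{u}) = 0,\qquad \boldsymbol{u}=(h,hu_m,h\alpha_1,\dots,h\alpha_N)^{\rm T},$$ where $$\mathbb{E}(\boldsymbol{u}) = \frac{h u_m^2}{2}+ \frac{h}{2}\sum_{i=1}^N\frac{\alpha_i^2}{2i+1}+ g \frac{h^2}{2}+g h b,$$ $$\mathbb{F}(\boldsymbol{u}) = \frac{h u_m^3}{2} + \frac{3}{2} h u_m \sum_{i=1}^N \frac{\alpha_i^2}{2i+1} + g h u_m (h+b) + \sum_{i,j,k=1}^N \frac{1}{2i+1} \left( A_{i j k} + B_{i j k}\right) h \alpha_i \alpha_j \alpha_k.$$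
   Context: $\Omega=(x_{\rm a},x_{\rm b})$ is an open interval, $N\ge 1$ is an integer, $g>0$ is the gravitational constant, and $b=b(x)$ is a given smooth time-independent bathymetry function. The unknowns are $h=h(x,t)$ (water height), $u_m=u_m(x,t)$ (mean velocity) and $\alpha_i=\alpha_i(x,t)$ (moments), $i=1,\dots,N$. Let $L_i$ be the classical Legendre polynomials on $[-1,1]$ (normalized by $L_i(1)=1$) and $\phi_i(\zeta)=(-1)^iL_i(2\zeta-1)$ for $0\le\zeta\le 1$, the shifted Legendre polynomials, so that $\phi_i(0)=1$. The coefficients are, for $i,j,k=1,\dots,N$, $$A_{i j k} =(2i+1) \int_0^1 \phi_i(\zeta) \phi_j(\zeta) \phi_k(\zeta)\, {\rm d} \zeta, \qquad B_{i j k} = (2 i+1) \int_0^1 \phi_i^{\prime}(\zeta)\left(\int_0^\zeta \phi_j(s)\,{\rm d} s\right) \phi_k(\zeta)\, {\rm d} \zeta.$$ *)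

theory Defs
  imports "HOL-Analysis.Analysis" "HOL-Computational_Algebra.Polynomial"
begin

text \<open>Smoothness means \<open>C\<^sup>\<infinity>\<close>. The set is open wherever the predicate is used, so the
  derivatives are taken at interior points.\<close>

primrec higher_differentiable_on ::
  "'a::real_normed_vector set \<Rightarrow> ('a \<Rightarrow> 'b::real_normed_vector) \<Rightarrow> nat \<Rightarrow> bool" where
  "higher_differentiable_on S f 0 \<longleftrightarrow> continuous_on S f"
| "higher_differentiable_on S f (Suc n) \<longleftrightarrow>
     (\<forall>x\<in>S. f differentiable (at x)) \<and>
     (\<forall>v. higher_differentiable_on S (\<lambda>x. frechet_derivative f (at x) v) n)"

definition smooth_on :: "'a::real_normed_vector set \<Rightarrow> ('a \<Rightarrow> 'b::real_normed_vector) \<Rightarrow> bool" where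
  "smooth_on S f \<longleftrightarrow> (\<forall>n. higher_differentiable_on S f n)"

definition Dx :: "(real \<Rightarrow> real \<Rightarrow> real) \<Rightarrow> real \<Rightarrow> real \<Rightarrow> real" where
  "Dx f x t = deriv (\<lambda>y. f y t) x"

definition Dt :: "(real \<Rightarrow> real \<Rightarrow> real) \<Rightarrow> real \<Rightarrow> real \<Rightarrow> real" where
  "Dt f x t = deriv (\<lambda>s. f x s) t"

text \<open>Rodrigues' formula; it gives the value 1 at 1.\<close>

definition legendre :: "nat \<Rightarrow> real poly" where
  "legendre n = smult (1 / (2 ^ n * fact n)) ((pderiv ^^ n) ([:-1, 0, 1:] ^ n))"

definition phi :: "nat \<Rightarrow> real \<Rightarrow> real" where
  "phi i \<zeta> = (-1) ^ i * poly (legendre i) (2 * \<zeta> - 1)"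

definition coeffA :: "nat \<Rightarrow> nat \<Rightarrow> nat \<Rightarrow> real" where
  "coeffA i j k = (2 * real i + 1) * integral {0..1} (\<lambda>\<zeta>. phi i \<zeta> * phi j \<zeta> * phi k \<zeta>)"

definition coeffB :: "nat \<Rightarrow> nat \<Rightarrow> nat \<Rightarrow> real" where
  "coeffB i j k = (2 * real i + 1) *
     integral {0..1} (\<lambda>\<zeta>. deriv (phi i) \<zeta> * integral {0..\<zeta>} (phi j) * phi k \<zeta>)"

text \<open>The moments \<open>\<alpha>\<^sub>1, \<dots>, \<alpha>\<^sub>N\<close> are given by a family indexed by \<^typ>\<open>nat\<close>, of which
  only the members with index in \<open>{1..N}\<close> are used.\<close>

definition swme_at ::
  "real \<Rightarrow> nat \<Rightarrow> (real \<Rightarrow> real) \<Rightarrow> (real \<Rightarrow> real \<Rightarrow> real) \<Rightarrow> (real \<Rightarrow> real \<Rightarrow> real) \<Rightarrow>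
   (nat \<Rightarrow> real \<Rightarrow> real \<Rightarrow> real) \<Rightarrow> real \<Rightarrow> real \<Rightarrow> bool" where
  "swme_at g N b h um \<alpha> x t \<longleftrightarrow>
     Dt h x t + Dx (\<lambda>x t. h x t * um x t) x t = 0 \<and>
     Dt (\<lambda>x t. h x t * um x t) x t
       + Dx (\<lambda>x t. h x t * (um x t)\<^sup>2 + h x t * (\<Sum>i=1..N. (\<alpha> i x t)\<^sup>2 / (2 * real i + 1))
                    + 1/2 * g * (h x t)\<^sup>2) x t
       = - (g * h x t * deriv b x) \<and>
     (\<forall>i\<in>{1..N}.
       Dt (\<lambda>x t. h x t * \<alpha> i x t) x t
         + Dx (\<lambda>x t. 2 * h x t * um x t * \<alpha> i x t
                      + h x t * (\<Sum>j=1..N. \<Sum>k=1..N. coeffA i j k * \<alpha> j x t * \<alpha> k x t)) x t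
       = um x t * Dx (\<lambda>x t. h x t * \<alpha> i x t) x t
         - (\<Sum>j=1..N. \<Sum>k=1..N. coeffB i j k * \<alpha> k x t * Dx (\<lambda>x t. h x t * \<alpha> j x t) x t))"

text \<open>The state is \<open>u = (h, h u\<^sub>m, (h \<alpha>\<^sub>i)\<^sub>i)\<close>; for \<open>h > 0\<close> the primitive variables
  are recovered from it by division by \<open>h\<close>.\<close>

type_synonym state = "real \<times> real \<times> (nat \<Rightarrow> real)"

definition conserved_state ::
  "(real \<Rightarrow> real \<Rightarrow> real) \<Rightarrow> (real \<Rightarrow> real \<Rightarrow> real) \<Rightarrow> (nat \<Rightarrow> real \<Rightarrow> real \<Rightarrow> real) \<Rightarrow>
   real \<Rightarrow> real \<Rightarrow> state" where
  "conserved_state h um \<alpha> x t = (h x t, h x t * um x t, (\<lambda>i. h x t * \<alpha> i x t))"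

text \<open>In the energy and its flux, \<open>z\<close> is the bathymetry \<open>b(x)\<close> at the point considered.\<close>

definition total_energy :: "real \<Rightarrow> nat \<Rightarrow> real \<Rightarrow> state \<Rightarrow> real" where
  "total_energy g N z u = (case u of (h, q, m) \<Rightarrow>
     let um = q / h; \<alpha> = (\<lambda>i. m i / h) in
       h * um\<^sup>2 / 2 + h / 2 * (\<Sum>i=1..N. (\<alpha> i)\<^sup>2 / (2 * real i + 1)) + g * h\<^sup>2 / 2 + g * h * z)"

definition energy_flux :: "real \<Rightarrow> nat \<Rightarrow> real \<Rightarrow> state \<Rightarrow> real" where
  "energy_flux g N z u = (case u of (h, q, m) \<Rightarrow>
     let um = q / h; \<alpha> = (\<lambda>i. m i / h) in
       h * um ^ 3 / 2 + 3/2 * h * um * (\<Sum>i=1..N. (\<alpha> i)\<^sup>2 / (2 * real i + 1))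
       + g * h * um * (h + z)
       + (\<Sum>i=1..N. \<Sum>j=1..N. \<Sum>k=1..N.
            1 / (2 * real i + 1) * (coeffA i j k + coeffB i j k) * h * \<alpha> i * \<alpha> j * \<alpha> k))"

end

theory Submission
  imports Defs
begin

text \<open>
  The energy is a quadratic form in \<open>h u\<^sub>m\<close> and \<open>h \<alpha>\<^sub>i\<close> divided by \<open>h\<close>, plus potential energy.
  Its derivatives with respect to the conserved variables \<open>h\<close>, \<open>h u\<^sub>m\<close>, \<open>h \<alpha>\<^sub>i\<close> are
  \<open>-u\<^sub>m\<^sup>2/2 - S/2 + g (h + b)\<close>, \<open>u\<^sub>m\<close> and \<open>\<alpha>\<^sub>i/(2i+1)\<close>, where \<open>S = \<Sum> \<alpha>\<^sub>i\<^sup>2/(2i+1)\<close>.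
  Multiplying the equations by these and adding them gives \<open>\<partial>\<^sub>t E\<close>. The terms with \<open>u\<^sub>m\<close>, \<open>g\<close>
  and \<open>b\<close> combine into an exact derivative by the product rule. The issue is the part that is
  cubic in the moments, where the \<open>B\<close> terms are not in divergence form.

  Put \<open>a\<^sub>i\<^sub>j\<^sub>k = A\<^sub>i\<^sub>j\<^sub>k/(2i+1)\<close> and \<open>c\<^sub>i\<^sub>j\<^sub>k = B\<^sub>i\<^sub>j\<^sub>k/(2i+1)\<close>. Then \<open>a\<close> is symmetric in all indices, and
  \<open>c\<^sub>i\<^sub>j\<^sub>k + c\<^sub>k\<^sub>j\<^sub>i = \<integral> (\<phi>\<^sub>i \<phi>\<^sub>k)' \<Phi>\<^sub>j = - a\<^sub>i\<^sub>j\<^sub>k\<close> by parts (\<open>scaledB_symmetrization\<close>), since the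
  primitive \<open>\<Phi>\<^sub>j\<close> of \<open>\<phi>\<^sub>j\<close> vanishes at 0 and 1: for \<open>j \<ge> 1\<close> the polynomial \<open>\<phi>\<^sub>j\<close> has mean zero
  (\<open>integral_phi_eq_0\<close>). Write \<open>T(x,y,z) = \<Sum> a\<^sub>i\<^sub>j\<^sub>k x\<^sub>i y\<^sub>j z\<^sub>k\<close>. In every sum in which \<open>c\<close> occurs it is
  paired with \<open>\<alpha>\<^sub>i \<alpha>\<^sub>k\<close>, so \<open>c\<close> acts as \<open>-a/2\<close> (\<open>trilinear_half_symmetrization\<close>). The cubic flux is
  therefore \<open>h T(\<alpha>,\<alpha>,\<alpha>)/2\<close>, and the cubic terms of the tested moment equations
  (\<open>tested_moment_equations\<close>) are
  \<open>h' T(\<alpha>,\<alpha>,\<alpha>) + 2 h T(\<alpha>,\<alpha>',\<alpha>) - (h' T(\<alpha>,\<alpha>,\<alpha>) + h T(\<alpha>,\<alpha>',\<alpha>))/2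
    = (h' T(\<alpha>,\<alpha>,\<alpha>) + 3 h T(\<alpha>,\<alpha>',\<alpha>))/2\<close> (here primes are \<open>x\<close>-derivatives),
  which is exactly the derivative of that flux.
\<close>

section \<open>Legendre polynomials of positive degree have mean zero\<close>

lemma power_dvd_pderiv:
  fixes q :: "'a::idom poly"
  assumes "q ^ Suc m dvd r"
  shows "q ^ m dvd pderiv r"
proof -
  obtain s where "r = q ^ Suc m * s"
    using assms by blast
  then have "pderiv r = q ^ Suc m * pderiv s + s * (smult (of_nat (Suc m)) (q ^ m) * pderiv q)"
    by (simp only: pderiv_mult pderiv_power_Suc)
  moreover have "q ^ m dvd q ^ Suc m * pderiv s"
    by simp
  moreover have "q ^ m dvd s * (smult (of_nat (Suc m)) (q ^ m) * pderiv q)"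
    by (intro dvd_mult dvd_mult2 dvd_smult dvd_refl)
  ultimately show ?thesis by (metis dvd_add)
qed

lemma power_dvd_higher_pderiv:
  fixes q :: "'a::idom poly"
  shows "q ^ m dvd (pderiv ^^ n) (q ^ (m + n))"
proof (induction n arbitrary: m)
  case (Suc n)
  then show ?case using power_dvd_pderiv Suc[of "Suc m"] by simp
qed simp

text \<open>By Rodrigues' formula the antiderivative of \<open>L\<^sub>n\<close> is a multiple of the \<open>(n-1)\<close>-st
  derivative of \<open>(x\<^sup>2 - 1)\<^sup>n\<close>, which still has a factor \<open>x\<^sup>2 - 1\<close> and so vanishes at both
  ends of \<open>[-1,1]\<close>.\<close>

lemma legendre_antiderivative:
  assumes "n \<ge> 1"
  obtains P where "pderiv P = legendre n" "poly P 1 = 0" "poly P (-1) = 0"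
proof -
  obtain m where n: "n = Suc m" using assms by (cases n) auto
  let ?q = "[:-1, 0, 1:] :: real poly"
  let ?r = "(pderiv ^^ m) (?q ^ n)"
  let ?P = "smult (1 / (2 ^ n * fact n)) ?r"
  have "?q dvd ?r"
    using power_dvd_higher_pderiv[of ?q 1 m] n by simp
  then have "poly ?r 1 = 0" "poly ?r (-1) = 0"
    by (auto simp: dvd_def)
  moreover have "pderiv ?P = legendre n"
    by (simp add: legendre_def n pderiv_smult)
  ultimately show ?thesis
    using that[of ?P] by simp
qed

definition phi_poly :: "nat \<Rightarrow> real poly" where
  "phi_poly i = smult ((-1) ^ i) (pcompose (legendre i) [:-1, 2:])"

lemma phi_eq_poly: "phi i = poly (phi_poly i)"
  by (simp add: fun_eq_iff phi_def phi_poly_def poly_pcompose algebra_simps)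

lemma phi_has_deriv: "(phi i has_real_derivative deriv (phi i) x) (at x within S)"
  by (metis DERIV_imp_deriv has_field_derivative_at_within phi_eq_poly poly_DERIV)

lemma continuous_on_phi: "continuous_on S (phi i)"
  unfolding phi_eq_poly by (rule continuous_on_poly[OF continuous_on_id])

lemma continuous_on_deriv_phi: "continuous_on S (deriv (phi i))"
proof -
  have "deriv (phi i) = poly (pderiv (phi_poly i))"
    by (metis DERIV_imp_deriv ext phi_eq_poly poly_DERIV)
  then show ?thesis by (simp add: continuous_on_poly[OF continuous_on_id])
qed

lemma integral_phi_eq_0:
  assumes "j \<ge> 1"
  shows "integral {0..1} (phi j) = 0"
proof -
  obtain P where P: "pderiv P = legendre j" "poly P 1 = 0" "poly P (-1) = 0"
    using legendre_antiderivative[OF assms] by blast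
  define G where "G \<zeta> = (-1) ^ j * poly P (2 * \<zeta> - 1) / 2" for \<zeta> :: real
  have "(G has_real_derivative phi j x) (at x within {0..1})" for x
  proof -
    have "((\<lambda>\<zeta>. poly P (2 * \<zeta> - 1)) has_real_derivative poly (pderiv P) (2 * x - 1) * 2)
            (at x within {0..1})"
      by (rule DERIV_chain2[OF poly_DERIV]) (auto intro!: derivative_eq_intros)
    then show ?thesis
      unfolding G_def phi_def P(1)[symmetric]
      by (auto intro!: derivative_eq_intros)
  qed
  then have "(phi j has_integral (G 1 - G 0)) {0..1}"
    by (intro fundamental_theorem_of_calculus)
       (auto simp: has_real_derivative_iff_has_vector_derivative)
  then show ?thesis
    by (simp add: G_def P integral_unique)
qed

section \<open>The coefficient tensors\<close>

text \<open>The factor \<open>2i + 1\<close> in the coefficients is the inverse of \<open>\<integral> \<phi>\<^sub>i\<^sup>2\<close>. Without it the tensors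
  are plain integrals, whose symmetries are visible.\<close>

definition scaledA :: "nat \<Rightarrow> nat \<Rightarrow> nat \<Rightarrow> real" where
  "scaledA i j k = coeffA i j k / (2 * real i + 1)"

definition scaledB :: "nat \<Rightarrow> nat \<Rightarrow> nat \<Rightarrow> real" where
  "scaledB i j k = coeffB i j k / (2 * real i + 1)"

lemma scaledA_eq: "scaledA i j k = integral {0..1} (\<lambda>\<zeta>. phi i \<zeta> * phi j \<zeta> * phi k \<zeta>)"
proof -
  have "2 * real i + 1 \<noteq> 0" by linarith
  then show ?thesis by (simp add: scaledA_def coeffA_def)
qed

lemma scaledB_eq:
  "scaledB i j k = integral {0..1} (\<lambda>\<zeta>. deriv (phi i) \<zeta> * integral {0..\<zeta>} (phi j) * phi k \<zeta>)"
proof -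
  have "2 * real i + 1 \<noteq> 0" by linarith
  then show ?thesis by (simp add: scaledB_def coeffB_def)
qed

lemma scaledA_symmetric: "scaledA i j k = scaledA j i k" "scaledA i j k = scaledA i k j"
  by (simp_all add: scaledA_eq ac_simps)

text \<open>With
  \<open>\<Phi>\<^sub>j(\<zeta>) = \<integral>\<^sub>0\<^sup>\<zeta> \<phi>\<^sub>j\<close>, the left-hand side is the integral of
  \<open>(\<phi>\<^sub>i \<phi>\<^sub>k)' \<Phi>\<^sub>j\<close>; an integration by parts moves the derivative to \<open>\<Phi>\<^sub>j\<close>. The boundary
  term at 1 vanishes because \<open>\<phi>\<^sub>j\<close> has mean zero, which is why \<open>j \<ge> 1\<close> is required.\<close>

lemma scaledB_symmetrization:
  assumes "j \<ge> 1"
  shows "scaledB i j k + scaledB k j i = - scaledA i j k"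
proof -
  define \<Phi> where "\<Phi> \<zeta> = integral {0..\<zeta>} (phi j)" for \<zeta>
  have \<Phi>': "(\<Phi> has_real_derivative phi j x) (at x within {0..1})" if "x \<in> {0..1}" for x
    unfolding \<Phi>_def by (rule integral_has_real_derivative[OF continuous_on_phi that])
  have cont\<Phi>: "continuous_on {0..1} \<Phi>"
    using \<Phi>' DERIV_continuous_on by blast
  note cont = continuous_on_phi continuous_on_deriv_phi cont\<Phi>
  let ?f = "\<lambda>\<zeta>. deriv (phi i) \<zeta> * \<Phi> \<zeta> * phi k \<zeta>"
  let ?g = "\<lambda>\<zeta>. deriv (phi k) \<zeta> * \<Phi> \<zeta> * phi i \<zeta>"
  let ?a = "\<lambda>\<zeta>. phi i \<zeta> * phi j \<zeta> * phi k \<zeta>"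
  have int: "?f integrable_on {0..1}" "?g integrable_on {0..1}" "?a integrable_on {0..1}"
    by (intro integrable_continuous_real continuous_intros cont)+
  have "((\<lambda>\<zeta>. phi i \<zeta> * phi k \<zeta> * \<Phi> \<zeta>) has_real_derivative ?f x + ?g x + ?a x)
          (at x within {0..1})" if "x \<in> {0..1}" for x
    by (auto intro!: derivative_eq_intros phi_has_deriv \<Phi>'[OF that] simp: algebra_simps)
  then have "((\<lambda>x. ?f x + ?g x + ?a x) has_integral
               phi i 1 * phi k 1 * \<Phi> 1 - phi i 0 * phi k 0 * \<Phi> 0) {0..1}"
    by (intro fundamental_theorem_of_calculus)
       (auto simp: has_real_derivative_iff_has_vector_derivative)
  moreover have "\<Phi> 0 = 0" "\<Phi> 1 = 0"
    using integral_phi_eq_0[OF assms] by (simp_all add: \<Phi>_def)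
  ultimately have "integral {0..1} (\<lambda>x. ?f x + ?g x + ?a x) = 0"
    by (simp add: integral_unique)
  then have "integral {0..1} ?f + integral {0..1} ?g = - integral {0..1} ?a"
    using int by (simp add: integral_add integrable_add)
  then show ?thesis
    by (simp add: scaledA_eq scaledB_eq \<Phi>_def)
qed

section \<open>Trilinear forms\<close>

text \<open>The cubic terms of the balance mix \<open>\<alpha>\<close> with its derivatives, so the three arguments
  are kept separate.\<close>

definition trilinear ::
  "'a set \<Rightarrow> ('a \<Rightarrow> 'a \<Rightarrow> 'a \<Rightarrow> real) \<Rightarrow> ('a \<Rightarrow> real) \<Rightarrow> ('a \<Rightarrow> real) \<Rightarrow> ('a \<Rightarrow> real) \<Rightarrow> real" where
  "trilinear I c x y z = (\<Sum>i\<in>I. \<Sum>j\<in>I. \<Sum>k\<in>I. c i j k * x i * y j * z k)"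

lemma trilinear_cong:
  assumes "\<And>i j k. i \<in> I \<Longrightarrow> j \<in> I \<Longrightarrow> k \<in> I \<Longrightarrow> c i j k = d i j k"
  shows "trilinear I c x y z = trilinear I d x y z"
  unfolding trilinear_def using assms by (intro sum.cong) auto

lemma trilinear_swap_12: "trilinear I c x y z = trilinear I (\<lambda>i j k. c j i k) y x z"
  unfolding trilinear_def by (subst sum.swap) (simp add: ac_simps)

lemma trilinear_swap_23: "trilinear I c x y z = trilinear I (\<lambda>i j k. c i k j) x z y"
  unfolding trilinear_def by (subst (2) sum.swap) (simp add: ac_simps)

lemma trilinear_swap_13: "trilinear I c x y z = trilinear I (\<lambda>i j k. c k j i) z y x"
  by (subst trilinear_swap_12, subst trilinear_swap_23, subst trilinear_swap_12) simp

lemma trilinear_add_coeff: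
  "trilinear I (\<lambda>i j k. c i j k + d i j k) x y z = trilinear I c x y z + trilinear I d x y z"
  by (simp add: trilinear_def distrib_right sum.distrib)

lemma trilinear_uminus_coeff:
  "trilinear I (\<lambda>i j k. - c i j k) x y z = - trilinear I c x y z"
  by (simp add: trilinear_def sum_negf)

lemma trilinear_linear_2:
  "trilinear I c x (\<lambda>j. r * y j + s * y' j) z = r * trilinear I c x y z + s * trilinear I c x y' z"
  by (simp add: trilinear_def sum_distrib_left sum.distrib[symmetric] algebra_simps)

text \<open>Exchanging the outer indices does not change the sum because the outer arguments agree,
  so \<open>c\<close> may be averaged with its transpose; \<open>y\<close> is arbitrary, which admits \<open>y = \<alpha>\<close> in the
  flux and \<open>y = \<partial>\<^sub>x(h \<alpha>)\<close> in the equations.\<close>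

lemma trilinear_half_symmetrization:
  assumes "\<And>i j k. i \<in> I \<Longrightarrow> j \<in> I \<Longrightarrow> k \<in> I \<Longrightarrow> c i j k + c k j i = - a i j k"
  shows "trilinear I c x y x = - trilinear I a x y x / 2"
proof -
  have "2 * trilinear I c x y x = trilinear I (\<lambda>i j k. c i j k + c k j i) x y x"
    by (simp add: trilinear_add_coeff trilinear_swap_13[of I c x y x, symmetric])
  also have "\<dots> = - trilinear I a x y x"
    unfolding trilinear_uminus_coeff[symmetric] by (rule trilinear_cong) (rule assms)
  finally show ?thesis by simp
qed

text \<open>The product rule gives one term for each slot; they coincide by symmetry.\<close>

lemma has_real_derivative_symmetric_cubic:
  assumes "\<And>i. i \<in> I \<Longrightarrow> ((\<lambda>s. x i s) has_real_derivative x' i) (at s)"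
    and sym: "\<And>i j k. i \<in> I \<Longrightarrow> j \<in> I \<Longrightarrow> k \<in> I \<Longrightarrow> a i j k = a j i k \<and> a i j k = a i k j"
  shows "((\<lambda>s. trilinear I a (\<lambda>i. x i s) (\<lambda>i. x i s) (\<lambda>i. x i s)) has_real_derivative
            3 * trilinear I a (\<lambda>i. x i s) x' (\<lambda>i. x i s)) (at s)"
proof -
  let ?x = "\<lambda>i. x i s"
  have "((\<lambda>s. trilinear I a (\<lambda>i. x i s) (\<lambda>i. x i s) (\<lambda>i. x i s)) has_real_derivative
          trilinear I a x' ?x ?x + trilinear I a ?x x' ?x + trilinear I a ?x ?x x') (at s)"
    unfolding trilinear_def sum.distrib[symmetric]
    by (intro DERIV_sum) (auto intro!: derivative_eq_intros assms(1) simp: algebra_simps)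
  moreover have "trilinear I a x' ?x ?x = trilinear I a ?x x' ?x"
    by (subst trilinear_swap_12) (auto intro!: trilinear_cong simp: sym)
  moreover have "trilinear I a ?x ?x x' = trilinear I a ?x x' ?x"
    by (subst trilinear_swap_23) (auto intro!: trilinear_cong simp: sym)
  ultimately show ?thesis by simp
qed

lemma trilinear_scaledB:
  "trilinear {1..N} scaledB x y x = - trilinear {1..N} scaledA x y x / 2"
  by (rule trilinear_half_symmetrization) (simp add: scaledB_symmetrization)

section \<open>Partial derivatives of smooth functions\<close>

lemma smooth_on_imp_differentiable:
  assumes "smooth_on S f" "x \<in> S"
  shows "f differentiable (at x)"
proof -
  have "higher_differentiable_on S f (Suc 0)"
    using assms(1) unfolding smooth_on_def by blast
  then show ?thesis using assms(2) by simp
qed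

lemma has_real_derivative_Dx:
  assumes "(\<lambda>(x, t). f x t) differentiable (at (x, t))"
  shows "((\<lambda>y. f y t) has_real_derivative Dx f x t) (at x)"
proof -
  have "(\<lambda>y. (y, t)) differentiable (at x)"
    unfolding differentiable_def
    by (rule exI, rule has_derivative_Pair[OF has_derivative_ident has_derivative_const])
  from differentiable_chain_at[OF this assms] show ?thesis
    unfolding Dx_def by (simp add: DERIV_deriv_iff_real_differentiable o_def)
qed

lemma has_real_derivative_Dt:
  assumes "(\<lambda>(x, t). f x t) differentiable (at (x, t))"
  shows "((\<lambda>s. f x s) has_real_derivative Dt f x t) (at t)"
proof -
  have "(\<lambda>s. (x, s)) differentiable (at t)"
    unfolding differentiable_def
    by (rule exI, rule has_derivative_Pair[OF has_derivative_const has_derivative_ident])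
  from differentiable_chain_at[OF this assms] show ?thesis
    unfolding Dt_def by (simp add: DERIV_deriv_iff_real_differentiable o_def)
qed

section \<open>Energy and flux in the primitive variables\<close>

definition shear_energy :: "nat \<Rightarrow> (nat \<Rightarrow> real) \<Rightarrow> real" where
  "shear_energy N \<alpha> = (\<Sum>i=1..N. (\<alpha> i)\<^sup>2 / (2 * real i + 1))"

definition shear_product :: "nat \<Rightarrow> (nat \<Rightarrow> real) \<Rightarrow> (nat \<Rightarrow> real) \<Rightarrow> real" where
  "shear_product N \<alpha> \<beta> = (\<Sum>i=1..N. \<alpha> i * \<beta> i / (2 * real i + 1))"

lemma shear_product_self: "shear_product N \<alpha> \<alpha> = shear_energy N \<alpha>"
  by (simp add: shear_product_def shear_energy_def power2_eq_square)

lemma has_real_derivative_shear_energy: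
  assumes "\<And>i. i \<in> {1..N} \<Longrightarrow> ((\<lambda>s. \<alpha> i s) has_real_derivative \<alpha>' i) (at s)"
  shows "((\<lambda>s. shear_energy N (\<lambda>i. \<alpha> i s)) has_real_derivative
           2 * shear_product N (\<lambda>i. \<alpha> i s) \<alpha>') (at s)"
  unfolding shear_energy_def shear_product_def sum_distrib_left
  by (intro DERIV_sum DERIV_cong[OF DERIV_cdivide[OF DERIV_power[OF assms]]]) simp_all

lemma total_energy_primitive:
  assumes "h x t \<noteq> 0"
  shows "total_energy g N z (conserved_state h um \<alpha> x t)
           = h x t * (um x t)\<^sup>2 / 2 + h x t / 2 * shear_energy N (\<lambda>i. \<alpha> i x t)
             + g * (h x t)\<^sup>2 / 2 + g * h x t * z"
  using assms by (simp add: total_energy_def conserved_state_def Let_def shear_energy_def)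

text \<open>With all three arguments equal, a trilinear form only sees the symmetrization of its
  coefficients, so \<open>B\<close> cancels half of the contribution of \<open>A\<close> and the cubic part of the
  flux becomes a symmetric form, whose derivative is a single term.\<close>

lemma energy_flux_primitive:
  assumes "h x t \<noteq> 0"
  shows "energy_flux g N z (conserved_state h um \<alpha> x t)
           = h x t * um x t ^ 3 / 2 + 3/2 * h x t * um x t * shear_energy N (\<lambda>i. \<alpha> i x t)
             + g * h x t * um x t * (h x t + z)
             + h x t * trilinear {1..N} scaledA (\<lambda>i. \<alpha> i x t) (\<lambda>i. \<alpha> i x t) (\<lambda>i. \<alpha> i x t) / 2"
proof -
  let ?\<alpha> = "\<lambda>i. \<alpha> i x t"
  have "(\<Sum>i=1..N. \<Sum>j=1..N. \<Sum>k=1..N.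
           1 / (2 * real i + 1) * (coeffA i j k + coeffB i j k) * h x t * ?\<alpha> i * ?\<alpha> j * ?\<alpha> k)
        = h x t * trilinear {1..N} (\<lambda>i j k. scaledA i j k + scaledB i j k) ?\<alpha> ?\<alpha> ?\<alpha>"
    unfolding trilinear_def sum_distrib_left scaledA_def scaledB_def
    by (intro sum.cong refl) (simp add: add_divide_distrib algebra_simps)
  also have "\<dots> = h x t * trilinear {1..N} scaledA ?\<alpha> ?\<alpha> ?\<alpha> / 2"
    by (simp add: trilinear_add_coeff trilinear_scaledB del: One_nat_def)
  finally have cubic: "(\<Sum>i=1..N. \<Sum>j=1..N. \<Sum>k=1..N.
           1 / (2 * real i + 1) * (coeffA i j k + coeffB i j k) * h x t * ?\<alpha> i * ?\<alpha> j * ?\<alpha> k)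
        = h x t * trilinear {1..N} scaledA ?\<alpha> ?\<alpha> ?\<alpha> / 2" .
  show ?thesis
    by (simp only: energy_flux_def conserved_state_def Let_def prod.case shear_energy_def
        nonzero_mult_div_cancel_left[OF assms] cubic)
qed

section \<open>The energy balance\<close>

text \<open>The moment equations are tested with \<open>\<alpha>\<^sub>i / (2i + 1)\<close>, the derivative of the energy
  with respect to \<open>h \<alpha>\<^sub>i\<close>. In the sum, the factor \<open>B\<^sub>i\<^sub>j\<^sub>k\<close> meets \<open>\<alpha>\<^sub>i \<alpha>\<^sub>k\<close>, which is
  symmetric in \<open>i\<close> and \<open>k\<close>; this is the situation in which \<open>B\<close> may be replaced by \<open>-A/2\<close>,
  and it turns the non-conservative product into the last bracket on the right.\<close>

lemma tested_moment_equations: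
  fixes \<alpha> \<alpha>x \<alpha>t :: "nat \<Rightarrow> real"
  assumes eq: "\<And>i. i \<in> {1..N} \<Longrightarrow>
      ht * \<alpha> i + h * \<alpha>t i + 2 * (hx * u * \<alpha> i + h * ux * \<alpha> i + h * u * \<alpha>x i)
        + hx * (\<Sum>j=1..N. \<Sum>k=1..N. coeffA i j k * \<alpha> j * \<alpha> k)
        + h * (\<Sum>j=1..N. \<Sum>k=1..N. coeffA i j k * (\<alpha>x j * \<alpha> k + \<alpha> j * \<alpha>x k))
      = u * (hx * \<alpha> i + h * \<alpha>x i)
        - (\<Sum>j=1..N. \<Sum>k=1..N. coeffB i j k * \<alpha> k * (hx * \<alpha> j + h * \<alpha>x j))"
  defines "S \<equiv> shear_energy N \<alpha>"
    and "C \<equiv> trilinear {1..N} scaledA \<alpha> \<alpha> \<alpha>"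
    and "D \<equiv> trilinear {1..N} scaledA \<alpha> \<alpha>x \<alpha>"
  shows "ht * S + h * shear_product N \<alpha> \<alpha>t
           + 2 * (hx * u * S + h * ux * S + h * u * shear_product N \<alpha> \<alpha>x) + hx * C + 2 * h * D
         = u * (hx * S + h * shear_product N \<alpha> \<alpha>x) + (hx * C + h * D) / 2"
proof -
  have A: "(\<Sum>i=1..N. \<alpha> i / (2 * real i + 1) * (\<Sum>j=1..N. \<Sum>k=1..N. coeffA i j k * y j * z k))
             = trilinear {1..N} scaledA \<alpha> y z" for y z
    unfolding trilinear_def sum_distrib_left scaledA_def
    by (intro sum.cong refl) simp
  have B: "(\<Sum>i=1..N. \<alpha> i / (2 * real i + 1) * (\<Sum>j=1..N. \<Sum>k=1..N. coeffB i j k * \<alpha> k * y j))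
             = trilinear {1..N} scaledB \<alpha> y \<alpha>" for y
    unfolding trilinear_def sum_distrib_left scaledB_def
    by (intro sum.cong refl) simp
  have P: "(\<Sum>i=1..N. \<alpha> i / (2 * real i + 1) * y i) = shear_product N \<alpha> y" for y
    by (simp add: shear_product_def)
  have sym: "trilinear {1..N} scaledA \<alpha> \<alpha> \<alpha>x = D"
    unfolding D_def by (subst trilinear_swap_23) (simp add: scaledA_symmetric(2)[symmetric])
  have "(\<Sum>i=1..N. \<alpha> i / (2 * real i + 1) *
           (ht * \<alpha> i + h * \<alpha>t i + 2 * (hx * u * \<alpha> i + h * ux * \<alpha> i + h * u * \<alpha>x i)
            + hx * (\<Sum>j=1..N. \<Sum>k=1..N. coeffA i j k * \<alpha> j * \<alpha> k)
            + h * (\<Sum>j=1..N. \<Sum>k=1..N. coeffA i j k * (\<alpha>x j * \<alpha> k + \<alpha> j * \<alpha>x k))))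
        = (\<Sum>i=1..N. \<alpha> i / (2 * real i + 1) *
           (u * (hx * \<alpha> i + h * \<alpha>x i)
            - (\<Sum>j=1..N. \<Sum>k=1..N. coeffB i j k * \<alpha> k * (hx * \<alpha> j + h * \<alpha>x j))))"
    (is "(\<Sum>i=1..N. ?l i) = (\<Sum>i=1..N. ?r i)")
    by (intro sum.cong refl) (simp only: eq)
  moreover have "(\<Sum>i=1..N. ?l i) = ht * S + h * shear_product N \<alpha> \<alpha>t
      + 2 * (hx * u * S + h * ux * S + h * u * shear_product N \<alpha> \<alpha>x) + hx * C + 2 * h * D"
  proof -
    have "(\<Sum>i=1..N. ?l i)
      = (\<Sum>i=1..N. ht * (\<alpha> i / (2 * real i + 1) * \<alpha> i) + h * (\<alpha> i / (2 * real i + 1) * \<alpha>t i)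
          + 2 * hx * u * (\<alpha> i / (2 * real i + 1) * \<alpha> i)
          + 2 * h * ux * (\<alpha> i / (2 * real i + 1) * \<alpha> i)
          + 2 * h * u * (\<alpha> i / (2 * real i + 1) * \<alpha>x i)
          + hx * (\<alpha> i / (2 * real i + 1) * (\<Sum>j=1..N. \<Sum>k=1..N. coeffA i j k * \<alpha> j * \<alpha> k))
          + h * (\<alpha> i / (2 * real i + 1) * (\<Sum>j=1..N. \<Sum>k=1..N. coeffA i j k * \<alpha>x j * \<alpha> k))
          + h * (\<alpha> i / (2 * real i + 1) * (\<Sum>j=1..N. \<Sum>k=1..N. coeffA i j k * \<alpha> j * \<alpha>x k)))"
      by (simp only: distrib_left sum.distrib mult.assoc mult.left_commute)
    also have "\<dots> = ht * S + h * shear_product N \<alpha> \<alpha>t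
      + 2 * hx * u * S + 2 * h * ux * S + 2 * h * u * shear_product N \<alpha> \<alpha>x + hx * C + h * D + h * D"
      unfolding sum.distrib sum_distrib_left[symmetric] A P
      by (simp add: sym shear_product_self S_def C_def flip: D_def del: One_nat_def)
    finally show ?thesis by (simp add: algebra_simps)
  qed
  moreover have "(\<Sum>i=1..N. ?r i) = u * (hx * S + h * shear_product N \<alpha> \<alpha>x) + (hx * C + h * D) / 2"
  proof -
    have "(\<Sum>i=1..N. ?r i)
      = (\<Sum>i=1..N. u * hx * (\<alpha> i / (2 * real i + 1) * \<alpha> i) + u * h * (\<alpha> i / (2 * real i + 1) * \<alpha>x i)
          - \<alpha> i / (2 * real i + 1)
            * (\<Sum>j=1..N. \<Sum>k=1..N. coeffB i j k * \<alpha> k * (hx * \<alpha> j + h * \<alpha>x j)))"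
      by (simp only: distrib_left right_diff_distrib mult.assoc mult.left_commute)
    also have "\<dots> = u * hx * S + u * h * shear_product N \<alpha> \<alpha>x
        - trilinear {1..N} scaledB \<alpha> (\<lambda>j. hx * \<alpha> j + h * \<alpha>x j) \<alpha>"
      unfolding sum.distrib sum_subtractf sum_distrib_left[symmetric] B P
      by (simp add: shear_product_self S_def)
    also have "\<dots> = u * (hx * S + h * shear_product N \<alpha> \<alpha>x) + (hx * C + h * D) / 2"
      unfolding trilinear_linear_2 trilinear_scaledB C_def D_def by (simp add: field_simps)
    finally show ?thesis .
  qed
  ultimately show ?thesis by simp
qed

theorem theorem1:
  fixes xa xb g :: real and N :: nat and b :: "real \<Rightarrow> real"
    and h um :: "real \<Rightarrow> real \<Rightarrow> real" and \<alpha> :: "nat \<Rightarrow> real \<Rightarrow> real \<Rightarrow> real"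
  assumes "xa < xb" and "N \<ge> 1" and "g > 0"
    and "smooth_on {xa<..<xb} b"
    and "smooth_on ({xa<..<xb} \<times> {0<..}) (\<lambda>(x, t). h x t)"
    and "smooth_on ({xa<..<xb} \<times> {0<..}) (\<lambda>(x, t). um x t)"
    and "\<And>i. i \<in> {1..N} \<Longrightarrow> smooth_on ({xa<..<xb} \<times> {0<..}) (\<lambda>(x, t). \<alpha> i x t)"
    and "\<And>x t. x \<in> {xa<..<xb} \<Longrightarrow> t > 0 \<Longrightarrow> h x t > 0"
    and "\<And>x t. x \<in> {xa<..<xb} \<Longrightarrow> t > 0 \<Longrightarrow> swme_at g N b h um \<alpha> x t"
  defines "E \<equiv> (\<lambda>x t. total_energy g N (b x) (conserved_state h um \<alpha> x t))"
    and "F \<equiv> (\<lambda>x t. energy_flux g N (b x) (conserved_state h um \<alpha> x t))"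
  shows "\<forall>x\<in>{xa<..<xb}. \<forall>t>0.
           (\<lambda>s. E x s) differentiable (at t) \<and> (\<lambda>y. F y t) differentiable (at x) \<and>
           Dt E x t + Dx F x t = 0"
proof (intro ballI allI impI)
  fix x t :: real
  assume x: "x \<in> {xa<..<xb}" and t: "t > 0"
  then have xt: "(x, t) \<in> {xa<..<xb} \<times> {0<..}" by simp
  define ht hx ut ux where "ht = Dt h x t" "hx = Dx h x t" "ut = Dt um x t" "ux = Dx um x t"
  define \<alpha>t \<alpha>x bx where "\<alpha>t i = Dt (\<alpha> i) x t" "\<alpha>x i = Dx (\<alpha> i) x t" "bx = deriv b x" for i
  note defs = ht_hx_ut_ux_def \<alpha>t_\<alpha>x_bx_def
  note diff = smooth_on_imp_differentiable[OF assms(5) xt] smooth_on_imp_differentiable[OF assms(6) xt]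
    smooth_on_imp_differentiable[OF assms(7) xt]
  have dt: "((\<lambda>s. h x s) has_real_derivative ht) (at t)"
      "((\<lambda>s. um x s) has_real_derivative ut) (at t)"
      "\<And>i. i \<in> {1..N} \<Longrightarrow> ((\<lambda>s. \<alpha> i x s) has_real_derivative \<alpha>t i) (at t)"
    using has_real_derivative_Dt diff unfolding defs by blast+
  have dx: "((\<lambda>y. h y t) has_real_derivative hx) (at x)"
      "((\<lambda>y. um y t) has_real_derivative ux) (at x)"
      "\<And>i. i \<in> {1..N} \<Longrightarrow> ((\<lambda>y. \<alpha> i y t) has_real_derivative \<alpha>x i) (at x)"
    using has_real_derivative_Dx diff unfolding defs by blast+
  have dbx: "(b has_real_derivative bx) (at x)"
    using smooth_on_imp_differentiable[OF assms(4) x]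
    unfolding defs by (simp add: DERIV_deriv_iff_real_differentiable)
  define H U S where "H = h x t" "U = um x t" "S = shear_energy N (\<lambda>i. \<alpha> i x t)"
  define St Sx where "St = shear_product N (\<lambda>i. \<alpha> i x t) \<alpha>t" "Sx = shear_product N (\<lambda>i. \<alpha> i x t) \<alpha>x"
  define C where "C = trilinear {1..N} scaledA (\<lambda>i. \<alpha> i x t) (\<lambda>i. \<alpha> i x t) (\<lambda>i. \<alpha> i x t)"
  define D where "D = trilinear {1..N} scaledA (\<lambda>i. \<alpha> i x t) \<alpha>x (\<lambda>i. \<alpha> i x t)"
  note vals = H_U_S_def St_Sx_def C_def D_def
  have dS: "((\<lambda>s. shear_energy N (\<lambda>i. \<alpha> i x s)) has_real_derivative 2 * St) (at t)"
      "((\<lambda>y. shear_energy N (\<lambda>i. \<alpha> i y t)) has_real_derivative 2 * Sx) (at x)"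
    unfolding vals using dt(3) dx(3) by (auto intro: has_real_derivative_shear_energy)
  have dC: "((\<lambda>y. trilinear {1..N} scaledA (\<lambda>i. \<alpha> i y t) (\<lambda>i. \<alpha> i y t) (\<lambda>i. \<alpha> i y t))
      has_real_derivative 3 * D) (at x)"
    unfolding vals using dx(3) scaledA_symmetric
    by (intro has_real_derivative_symmetric_cubic) blast+

  have swme: "swme_at g N b h um \<alpha> x t"
    using assms(9) x t by blast
  have mass: "ht + (hx * U + H * ux) = 0"
  proof -
    have "Dx (\<lambda>x t. h x t * um x t) x t = hx * U + H * ux"
      unfolding Dx_def vals
      by (rule DERIV_imp_deriv) (auto intro!: derivative_eq_intros dx simp: algebra_simps)
    then show ?thesis using swme by (simp add: swme_at_def defs)
  qed
  have momentum: "(ht * U + H * ut)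
      + (hx * U\<^sup>2 + 2 * H * U * ux + hx * S + 2 * H * Sx + g * H * hx) = - (g * H * bx)"
  proof -
    have "Dt (\<lambda>x t. h x t * um x t) x t = ht * U + H * ut"
      unfolding Dt_def vals
      by (rule DERIV_imp_deriv) (auto intro!: derivative_eq_intros dt simp: algebra_simps)
    moreover have "Dx (\<lambda>x t. h x t * (um x t)\<^sup>2 + h x t * (\<Sum>i=1..N. (\<alpha> i x t)\<^sup>2 / (2 * real i + 1))
                    + 1/2 * g * (h x t)\<^sup>2) x t
        = hx * U\<^sup>2 + 2 * H * U * ux + hx * S + 2 * H * Sx + g * H * hx"
      unfolding Dx_def shear_energy_def[symmetric]
      by (rule DERIV_imp_deriv)
        (auto intro!: derivative_eq_intros dx dS simp: algebra_simps H_U_S_def)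
    ultimately show ?thesis using swme by (simp add: swme_at_def defs H_U_S_def)
  qed
  have "ht * \<alpha> i x t + H * \<alpha>t i + 2 * (hx * U * \<alpha> i x t + H * ux * \<alpha> i x t + H * U * \<alpha>x i)
        + hx * (\<Sum>j=1..N. \<Sum>k=1..N. coeffA i j k * \<alpha> j x t * \<alpha> k x t)
        + H * (\<Sum>j=1..N. \<Sum>k=1..N. coeffA i j k * (\<alpha>x j * \<alpha> k x t + \<alpha> j x t * \<alpha>x k))
      = U * (hx * \<alpha> i x t + H * \<alpha>x i)
        - (\<Sum>j=1..N. \<Sum>k=1..N. coeffB i j k * \<alpha> k x t * (hx * \<alpha> j x t + H * \<alpha>x j))"
    if i: "i \<in> {1..N}" for i
  proof -
    have "Dt (\<lambda>x t. h x t * \<alpha> i x t) x t = ht * \<alpha> i x t + H * \<alpha>t i"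
      unfolding Dt_def vals
      by (rule DERIV_imp_deriv) (auto intro!: derivative_eq_intros dt i simp: algebra_simps)
    moreover have pdx: "Dx (\<lambda>x t. h x t * \<alpha> j x t) x t = hx * \<alpha> j x t + H * \<alpha>x j"
      if "j \<in> {1..N}" for j
      unfolding Dx_def vals
      by (rule DERIV_imp_deriv) (auto intro!: derivative_eq_intros dx that simp: algebra_simps)
    moreover have "Dx (\<lambda>x t. 2 * h x t * um x t * \<alpha> i x t
          + h x t * (\<Sum>j=1..N. \<Sum>k=1..N. coeffA i j k * \<alpha> j x t * \<alpha> k x t)) x t
        = 2 * (hx * U * \<alpha> i x t + H * ux * \<alpha> i x t + H * U * \<alpha>x i)
          + hx * (\<Sum>j=1..N. \<Sum>k=1..N. coeffA i j k * \<alpha> j x t * \<alpha> k x t)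
          + H * (\<Sum>j=1..N. \<Sum>k=1..N. coeffA i j k * (\<alpha>x j * \<alpha> k x t + \<alpha> j x t * \<alpha>x k))"
    proof -
      have "((\<lambda>y. \<Sum>j=1..N. \<Sum>k=1..N. coeffA i j k * \<alpha> j y t * \<alpha> k y t) has_real_derivative
          (\<Sum>j=1..N. \<Sum>k=1..N. coeffA i j k * (\<alpha>x j * \<alpha> k x t + \<alpha> j x t * \<alpha>x k))) (at x)"
        by (intro DERIV_sum) (auto intro!: derivative_eq_intros dx simp: algebra_simps)
      then show ?thesis
        unfolding Dx_def vals
        by (intro DERIV_imp_deriv) (auto intro!: derivative_eq_intros dx i simp: algebra_simps)
    qed
    moreover have "(\<Sum>j=1..N. \<Sum>k=1..N. coeffB i j k * \<alpha> k x t * Dx (\<lambda>x t. h x t * \<alpha> j x t) x t)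
        = (\<Sum>j=1..N. \<Sum>k=1..N. coeffB i j k * \<alpha> k x t * (hx * \<alpha> j x t + H * \<alpha>x j))"
      by (intro sum.cong refl) (simp only: pdx)
    ultimately show ?thesis
      using swme i unfolding swme_at_def H_U_S_def by (metis (no_types, lifting) add.assoc)
  qed
  note moment = tested_moment_equations[OF this, folded vals]

  have pos: "h x s \<noteq> 0" if "s > 0" for s
    using assms(8)[OF x that] by simp
  have pos': "h y t \<noteq> 0" if "y \<in> {xa<..<xb}" for y
    using assms(8)[OF that t] by simp
  \<comment> \<open>\<open>E\<close> and \<open>F\<close> have their primitive form only where \<open>h \<noteq> 0\<close>, so it is differentiated on an
    open set on which \<open>h\<close> is positive.\<close>
  have dE: "((\<lambda>s. E x s) has_real_derivative
      ht * U\<^sup>2 / 2 + H * U * ut + ht / 2 * S + H * St + g * H * ht + g * ht * b x) (at t)"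
  proof (rule has_field_derivative_transform_within_open[where S = "{0<..}"])
    show "((\<lambda>s. h x s * (um x s)\<^sup>2 / 2 + h x s / 2 * shear_energy N (\<lambda>i. \<alpha> i x s)
        + g * (h x s)\<^sup>2 / 2 + g * h x s * b x) has_real_derivative
      ht * U\<^sup>2 / 2 + H * U * ut + ht / 2 * S + H * St + g * H * ht + g * ht * b x) (at t)"
      by (auto intro!: derivative_eq_intros dt dS simp: field_simps H_U_S_def)
  qed (use t in \<open>auto simp: E_def total_energy_primitive pos\<close>)
  have dF: "((\<lambda>y. F y t) has_real_derivative
      hx * U ^ 3 / 2 + 3/2 * H * U\<^sup>2 * ux + 3/2 * (hx * U * S + H * ux * S + 2 * H * U * Sx)
      + g * (hx * U * (H + b x) + H * ux * (H + b x) + H * U * (hx + bx))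
      + (hx * C + 3 * H * D) / 2) (at x)"
  proof (rule has_field_derivative_transform_within_open[where S = "{xa<..<xb}"])
    show "((\<lambda>y. h y t * um y t ^ 3 / 2 + 3/2 * h y t * um y t * shear_energy N (\<lambda>i. \<alpha> i y t)
        + g * h y t * um y t * (h y t + b y)
        + h y t * trilinear {1..N} scaledA (\<lambda>i. \<alpha> i y t) (\<lambda>i. \<alpha> i y t) (\<lambda>i. \<alpha> i y t) / 2)
      has_real_derivative
      hx * U ^ 3 / 2 + 3/2 * H * U\<^sup>2 * ux + 3/2 * (hx * U * S + H * ux * S + 2 * H * U * Sx)
      + g * (hx * U * (H + b x) + H * ux * (H + b x) + H * U * (hx + bx))
      + (hx * C + 3 * H * D) / 2) (at x)"
      by (auto intro!: derivative_eq_intros dx dS dC dbx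
          simp: field_simps H_U_S_def C_def power2_eq_square power3_eq_cube simp del: One_nat_def)
  qed (use x in \<open>auto simp: F_def energy_flux_primitive pos'\<close>)
  have "Dt E x t + Dx F x t = 0"
  proof -
    \<comment> \<open>The multipliers are the entropy variables, the derivatives of the energy with respect
      to \<open>h\<close>, \<open>h u\<^sub>m\<close> and \<open>h \<alpha>\<^sub>i\<close>; those of the moment equations, \<open>\<alpha>\<^sub>i / (2i + 1)\<close>, are
      already contained in the tested equation.\<close>
    have "Dt E x t + Dx F x t
      = (ht + (hx * U + H * ux)) * (- U\<^sup>2 / 2 - S / 2 + g * H + g * b x)
        + U * ((ht * U + H * ut)
            + (hx * U\<^sup>2 + 2 * H * U * ux + hx * S + 2 * H * Sx + g * H * hx) + g * H * bx)
        + ((ht * S + H * St + 2 * (hx * U * S + H * ux * S + H * U * Sx) + hx * C + 2 * H * D)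
            - (U * (hx * S + H * Sx) + (hx * C + H * D) / 2))"
      unfolding Dt_def Dx_def DERIV_imp_deriv[OF dE] DERIV_imp_deriv[OF dF]
      by (simp add: field_simps power2_eq_square power3_eq_cube)
    also have "\<dots> = 0"
      using mass momentum moment by simp
    finally show ?thesis .
  qed
  then show "(\<lambda>s. E x s) differentiable (at t) \<and> (\<lambda>y. F y t) differentiable (at x) \<and>
      Dt E x t + Dx F x t = 0"
    using dE dF by (auto simp: real_differentiable_def)
qed

end
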